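(* Let $L\in\mathcal{B}(\mathcal{E},\mathcal{F}_n^2\otimes\mathcal{E})$ satisfy $L\mathcal{E}\subseteq\mathcal{E}_L$. Then the odometer map $W_L$ with symbol $L$ satisfies $\|W_L\|=\max\{1,\|L\|\}$.
   Context: $n\ge1$ is an integer and $\mathcal{E}$ is a Hilbert space; Hilbert spaces are separable and complex; $\mathcal{B}(\mathcal{H},\mathcal{K})$ denotes the bounded linear operators from $\mathcal{H}$ to $\mathcal{K}$. $F_n^+$ is the free monoid of words $\mu=\mu_1\cdots\mu_m$ in the letters $1,\dots,n$, with empty word $\emptyset$. The full Fock space $\mathcal{F}_n^2=\mathbb{C}\Omega\oplus\bigoplus_{k\ge1}(\mathbb{C}^n)^{\otimes k}$ has orthonormal basis $e_\mu=e_{\mu_1}\otimes\cdots\otimes e_{\mu_m}$, $\mu\in F_n^+$, with $e_\emptyset=\Omega$; $e_k^m:=e_k^{\otimes m}$, $e_k^0=\Omega$, and $\Omega$ acts as a unit for left tensoring. For $f\in\mathcal{F}_n^2\otimes\mathcal{E}$, $e_1^p\otimes f$ means left tensoring by $e_1^p$. Odometer map: for $L\in\mathcal{B}(\mathcal{E},\mathcal{F}_n^2\otimes\mathcal{E})$, $W_L$ is the bounded operator on $\mathcal{F}_n^2\otimes\mathcal{E}$ given by $W_L(\Omega\otimes\eta)=L\eta$; $W_L(e_n^m\otimes\eta)=e_1^m\otimes L\eta$ for $m\ge1$; and, for a nonempty word $\mu=\mu_1\cdots\mu_m$ having some letter $\ne n$, with $k$ the smallest index such that $\mu_k\neq n$,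 $W_L(e_\mu\otimes\eta)=e_1^{k-1}\otimes e_{\mu_k+1}\otimes e_{\mu_{k+1}}\otimes\cdots\otimes e_{\mu_m}\otimes\eta$. $\mathcal{E}_L:=\overline{\mathrm{span}}\{e_1^m\otimes\eta:m\ge0,\eta\in\mathcal{E}\}\ominus\overline{\mathrm{span}}\{e_1^p\otimes L\zeta:p\ge1,\zeta\in\mathcal{E}\}$, meaning the set of vectors in the first subspace that are orthogonal to the second.
   Formalization: The formal theorem assumes E ≠ {0} and, when n = 1, ‖L‖ ≥ 1; the claim fails otherwise: for E = {0}, W_L = 0, and for n = 1 with ‖L‖ < 1 (e.g. L = 0) one has ‖W_L‖ = ‖L‖ < 1. *)

theory Defs
  imports "HOL-Analysis.Analysis"
begin

section \<open>Complex Hilbert spaces\<close>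

text \<open>
  Complex inner product spaces, as real inner product spaces with a compatible complex structure.
  Thus norm, topology, closure and operator norm (\<^const>\<open>onorm\<close>) are those of the library.
  The inner product \<open>cinner\<close> is linear in the first argument.
\<close>

class complex_inner = real_inner +
  fixes scaleC :: "complex \<Rightarrow> 'a \<Rightarrow> 'a" (infixr "*\<^sub>C" 75)
    and cinner :: "'a \<Rightarrow> 'a \<Rightarrow> complex"
  assumes scaleC_add_right: "c *\<^sub>C (x + y) = c *\<^sub>C x + c *\<^sub>C y"
    and scaleC_add_left: "(c + d) *\<^sub>C x = c *\<^sub>C x + d *\<^sub>C x"
    and scaleC_scaleC: "c *\<^sub>C d *\<^sub>C x = (c * d) *\<^sub>C x"
    and scaleC_of_real: "complex_of_real r *\<^sub>C x = r *\<^sub>R x"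
    and cinner_commute: "cinner x y = cnj (cinner y x)"
    and cinner_add_left: "cinner (x + y) z = cinner x z + cinner y z"
    and cinner_scaleC_left: "cinner (c *\<^sub>C x) y = c * cinner x y"
    and Re_cinner: "Re (cinner x y) = inner x y"

class chilbert_space = complex_inner + complete_space

instantiation complex :: chilbert_space
begin

definition scaleC_complex :: "complex \<Rightarrow> complex \<Rightarrow> complex"
  where "scaleC_complex = (*)"

definition cinner_complex :: "complex \<Rightarrow> complex \<Rightarrow> complex"
  where "cinner_complex x y = x * cnj y"

instance
  by standard (auto simp: scaleC_complex_def cinner_complex_def algebra_simps scaleR_conv_of_real
      inner_complex_def)

end

lemma scaleC_one [simp]: "1 *\<^sub>C (x :: 'a::complex_inner) = x"
  using scaleC_of_real[of 1 x] by simp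

global_interpretation complex_vector:
  vector_space "scaleC :: complex \<Rightarrow> 'a \<Rightarrow> 'a::complex_inner"
  defines cspan = complex_vector.span
  by unfold_locales (auto simp: scaleC_add_right scaleC_add_left scaleC_scaleC)

lemma scaleC_zero_left [simp]: "0 *\<^sub>C (x :: 'a::complex_inner) = 0"
  by (rule complex_vector.scale_zero_left)

lemma scaleC_zero_right [simp]: "c *\<^sub>C (0 :: 'a::complex_inner) = 0"
  by (rule complex_vector.scale_zero_right)

lemma cinner_self: "cinner x x = complex_of_real ((norm (x :: 'a::complex_inner))\<^sup>2)"
proof (rule complex_eqI)
  show "Re (cinner x x) = Re (complex_of_real ((norm x)\<^sup>2))"
    by (simp add: Re_cinner power2_norm_eq_inner)
  have "Im (cinner x x) = - Im (cinner x x)"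
    using arg_cong[OF cinner_commute[of x x], of Im] by simp
  then show "Im (cinner x x) = Im (complex_of_real ((norm x)\<^sup>2))" by simp
qed

lemma norm_scaleC [simp]: "norm (c *\<^sub>C (x :: 'a::complex_inner)) = cmod c * norm x"
proof -
  have "cinner (c *\<^sub>C x) (c *\<^sub>C x) = c * cnj (cinner (c *\<^sub>C x) x)"
    by (metis cinner_scaleC_left cinner_commute)
  also have "\<dots> = (c * cnj c) * complex_of_real ((norm x)\<^sup>2)"
    by (simp add: cinner_scaleC_left cinner_self)
  also have "\<dots> = complex_of_real ((cmod c * norm x)\<^sup>2)"
    by (simp add: complex_mult_cnj cmod_power2 power_mult_distrib)
  finally have "(norm (c *\<^sub>C x))\<^sup>2 = (cmod c * norm x)\<^sup>2"
    unfolding cinner_self of_real_eq_iff .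
  then show ?thesis by (rule power2_eq_imp_eq) auto
qed

lemma norm_cinner_le: "cmod (cinner x y) \<le> 2 * (norm x * norm (y :: 'a::complex_inner))"
proof -
  have "Im (cinner x y) = Re (cinner (- \<i> *\<^sub>C x) y)"
    by (simp only: cinner_scaleC_left) simp
  then have "\<bar>Im (cinner x y)\<bar> \<le> norm x * norm y"
    using Cauchy_Schwarz_ineq2[of "- \<i> *\<^sub>C x" y] by (simp add: Re_cinner)
  moreover have "\<bar>Re (cinner x y)\<bar> \<le> norm x * norm y"
    by (simp add: Re_cinner Cauchy_Schwarz_ineq2)
  ultimately show ?thesis
    using cmod_le[of "cinner x y"] by linarith
qed

definition bounded_clinear :: "('a::complex_inner \<Rightarrow> 'b::complex_inner) \<Rightarrow> bool"
  where "bounded_clinear T \<longleftrightarrow> bounded_linear T \<and> (\<forall>c x. T (c *\<^sub>C x) = c *\<^sub>C T x)"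

section \<open>Square-summable families\<close>

typedef (overloaded) ('i, 'a) ell2 =
  "{f :: 'i \<Rightarrow> 'a::complex_inner. (\<lambda>i. (norm (f i))\<^sup>2) summable_on UNIV}"
  morphisms ell2_nth Abs_ell2
  by (rule exI[of _ "\<lambda>_. 0"]) simp

setup_lifting type_definition_ell2

lemma ell2_eqI: "(\<And>i. ell2_nth f i = ell2_nth g i) \<Longrightarrow> f = g"
  by transfer auto

lemma ell2_summable: "(\<lambda>i. (norm (ell2_nth f i))\<^sup>2) summable_on UNIV"
  using ell2_nth[of f] by simp

lemma square_summable_add:
  fixes f g :: "'i \<Rightarrow> 'a::real_normed_vector"
  assumes "(\<lambda>i. (norm (f i))\<^sup>2) summable_on UNIV" "(\<lambda>i. (norm (g i))\<^sup>2) summable_on UNIV"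
  shows "(\<lambda>i. (norm (f i + g i))\<^sup>2) summable_on UNIV"
proof (rule summable_on_comparison_test)
  show "(\<lambda>i. 2 * (norm (f i))\<^sup>2 + 2 * (norm (g i))\<^sup>2) summable_on UNIV"
    by (intro summable_on_add summable_on_cmult_right assms)
  fix i
  have "(norm (f i + g i))\<^sup>2 \<le> (norm (f i) + norm (g i))\<^sup>2"
    by (intro power_mono norm_triangle_ineq) simp
  also have "\<dots> \<le> 2 * (norm (f i))\<^sup>2 + 2 * (norm (g i))\<^sup>2"
    using sum_squares_bound[of "norm (f i)" "norm (g i)"] by (simp add: power2_sum)
  finally show "(norm (f i + g i))\<^sup>2 \<le> 2 * (norm (f i))\<^sup>2 + 2 * (norm (g i))\<^sup>2" .
qed auto

lemma square_summable_prod: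
  fixes f g :: "'i \<Rightarrow> 'a::real_normed_vector"
  assumes "(\<lambda>i. (norm (f i))\<^sup>2) summable_on UNIV" "(\<lambda>i. (norm (g i))\<^sup>2) summable_on UNIV"
  shows "(\<lambda>i. 2 * (norm (f i) * norm (g i))) summable_on UNIV"
proof (rule summable_on_comparison_test)
  show "(\<lambda>i. (norm (f i))\<^sup>2 + (norm (g i))\<^sup>2) summable_on UNIV"
    by (intro summable_on_add assms)
  fix i
  show "2 * (norm (f i) * norm (g i)) \<le> (norm (f i))\<^sup>2 + (norm (g i))\<^sup>2"
    using sum_squares_bound[of "norm (f i)" "norm (g i)"] by simp
qed auto

lemma ell2_cinner_summable:
  "(\<lambda>i. cinner (ell2_nth f i) (ell2_nth g i)) summable_on UNIV"
proof (rule abs_summable_summable)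
  have "(\<lambda>i. 2 * (norm (ell2_nth f i) * norm (ell2_nth g i))) summable_on UNIV"
    by (intro square_summable_prod ell2_summable)
  then show "(\<lambda>i. norm (cinner (ell2_nth f i) (ell2_nth g i))) summable_on UNIV"
    by (rule Infinite_Sum.abs_summable_on_comparison_test') (rule norm_cinner_le)
qed

lemma ell2_inner_summable:
  "(\<lambda>i. inner (ell2_nth f i) (ell2_nth g i)) summable_on UNIV"
  using summable_on_Re[OF ell2_cinner_summable[of f g]] by (simp add: Re_cinner)

instantiation ell2 :: (type, complex_inner) complex_inner
begin

lift_definition zero_ell2 :: "('a, 'b) ell2" is "\<lambda>_. 0" by simp

lift_definition plus_ell2 :: "('a, 'b) ell2 \<Rightarrow> ('a, 'b) ell2 \<Rightarrow> ('a, 'b) ell2"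
  is "\<lambda>f g i. f i + g i" by (rule square_summable_add)

lift_definition uminus_ell2 :: "('a, 'b) ell2 \<Rightarrow> ('a, 'b) ell2"
  is "\<lambda>f i. - f i" by simp

lift_definition minus_ell2 :: "('a, 'b) ell2 \<Rightarrow> ('a, 'b) ell2 \<Rightarrow> ('a, 'b) ell2"
  is "\<lambda>f g i. f i - g i"
  subgoal for f g using square_summable_add[of f "\<lambda>i. - g i"] by simp
  done

lift_definition scaleC_ell2 :: "complex \<Rightarrow> ('a, 'b) ell2 \<Rightarrow> ('a, 'b) ell2"
  is "\<lambda>c f i. c *\<^sub>C f i"
  by (auto simp: power_mult_distrib intro: summable_on_cmult_right)

lift_definition scaleR_ell2 :: "real \<Rightarrow> ('a, 'b) ell2 \<Rightarrow> ('a, 'b) ell2"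
  is "\<lambda>r f i. r *\<^sub>R f i"
  by (auto simp: power_mult_distrib intro: summable_on_cmult_right)

definition cinner_ell2 :: "('a, 'b) ell2 \<Rightarrow> ('a, 'b) ell2 \<Rightarrow> complex"
  where "cinner_ell2 f g = (\<Sum>\<^sub>\<infinity>i. cinner (ell2_nth f i) (ell2_nth g i))"

definition inner_ell2 :: "('a, 'b) ell2 \<Rightarrow> ('a, 'b) ell2 \<Rightarrow> real"
  where "inner_ell2 f g = (\<Sum>\<^sub>\<infinity>i. inner (ell2_nth f i) (ell2_nth g i))"

definition norm_ell2 :: "('a, 'b) ell2 \<Rightarrow> real"
  where "norm_ell2 f = sqrt (inner f f)"

definition sgn_ell2 :: "('a, 'b) ell2 \<Rightarrow> ('a, 'b) ell2"
  where "sgn_ell2 f = inverse (norm f) *\<^sub>R f"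

definition dist_ell2 :: "('a, 'b) ell2 \<Rightarrow> ('a, 'b) ell2 \<Rightarrow> real"
  where "dist_ell2 f g = norm (f - g)"

definition uniformity_ell2 :: "(('a, 'b) ell2 \<times> ('a, 'b) ell2) filter"
  where "uniformity_ell2 = (INF e\<in>{0<..}. principal {(x, y). dist x y < e})"

definition open_ell2 :: "('a, 'b) ell2 set \<Rightarrow> bool"
  where "open_ell2 U = (\<forall>x\<in>U. \<forall>\<^sub>F (x', y) in uniformity. x' = x \<longrightarrow> y \<in> U)"

instance
proof
  fix x y z :: "('a, 'b) ell2" and a b :: real and c d :: complex
  show "x + y + z = x + (y + z)" by transfer (simp add: add.assoc)
  show "x + y = y + x" by transfer (simp add: add.commute)
  show "0 + x = x" by transfer simp
  show "- x + x = 0" by transfer simp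
  show "x - y = x + - y" by transfer simp
  show "a *\<^sub>R (x + y) = a *\<^sub>R x + a *\<^sub>R y" by transfer (simp add: scaleR_add_right)
  show "(a + b) *\<^sub>R x = a *\<^sub>R x + b *\<^sub>R x" by transfer (simp add: scaleR_add_left)
  show "a *\<^sub>R b *\<^sub>R x = (a * b) *\<^sub>R x" by transfer simp
  show "1 *\<^sub>R x = x" by transfer simp
  show "sgn x = inverse (norm x) *\<^sub>R x" by (rule sgn_ell2_def)
  show "dist x y = norm (x - y)" by (rule dist_ell2_def)
  show "uniformity = (INF e\<in>{0<..}. principal {(x, y :: ('a, 'b) ell2). dist x y < e})"
    by (rule uniformity_ell2_def)
  show "open U = (\<forall>x\<in>U. \<forall>\<^sub>F (x', y) in uniformity. x' = x \<longrightarrow> y \<in> U)"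
    for U :: "('a, 'b) ell2 set" by (rule open_ell2_def)
  show "norm x = sqrt (inner x x)" by (rule norm_ell2_def)
  show "inner x y = inner y x" by (simp add: inner_ell2_def inner_commute)
  show "inner (x + y) z = inner x z + inner y z"
    by (simp add: inner_ell2_def plus_ell2.rep_eq inner_add_left infsum_add ell2_inner_summable)
  show "inner (a *\<^sub>R x) y = a * inner x y"
    by (simp add: inner_ell2_def scaleR_ell2.rep_eq infsum_cmult_right')
  show "0 \<le> inner x x" by (simp add: inner_ell2_def infsum_nonneg)
  show "(inner x x = 0) = (x = 0)"
  proof
    assume "inner x x = 0"
    then have "inner (ell2_nth x i) (ell2_nth x i) = 0" for i
      unfolding inner_ell2_def
      by (intro nonneg_infsum_le_0D[of "\<lambda>i. inner (ell2_nth x i) (ell2_nth x i)" UNIV])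
        (auto simp: ell2_inner_summable)
    then show "x = 0" by (intro ell2_eqI) (simp add: zero_ell2.rep_eq)
  qed (simp add: inner_ell2_def zero_ell2.rep_eq)
  show "c *\<^sub>C (x + y) = c *\<^sub>C x + c *\<^sub>C y" by transfer (simp add: scaleC_add_right)
  show "(c + d) *\<^sub>C x = c *\<^sub>C x + d *\<^sub>C x" by transfer (simp add: scaleC_add_left)
  show "c *\<^sub>C d *\<^sub>C x = (c * d) *\<^sub>C x" by transfer (simp add: scaleC_scaleC)
  show "complex_of_real a *\<^sub>C x = a *\<^sub>R x" by transfer (simp add: scaleC_of_real)
  show "cinner x y = cnj (cinner y x)"
    unfolding cinner_ell2_def infsum_cnj[symmetric] by (subst cinner_commute) simp
  show "cinner (x + y) z = cinner x z + cinner y z"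
    by (simp add: cinner_ell2_def plus_ell2.rep_eq cinner_add_left infsum_add ell2_cinner_summable)
  show "cinner (c *\<^sub>C x) y = c * cinner x y"
    by (simp add: cinner_ell2_def scaleC_ell2.rep_eq cinner_scaleC_left infsum_cmult_right')
  show "Re (cinner x y) = inner x y"
    by (simp add: cinner_ell2_def inner_ell2_def infsum_Re[OF ell2_cinner_summable, symmetric]
        Re_cinner)
qed

end

lemma ell2_norm_square: "(norm f)\<^sup>2 = (\<Sum>\<^sub>\<infinity>i. (norm (ell2_nth f i))\<^sup>2)"
  by (simp add: power2_norm_eq_inner inner_ell2_def)

lemma ell2_sum_le_norm:
  assumes "finite F"
  shows "(\<Sum>i\<in>F. (norm (ell2_nth f i))\<^sup>2) \<le> (norm f)\<^sup>2"
  unfolding ell2_norm_square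
  by (rule finite_sum_le_infsum) (auto simp: assms ell2_summable)

lemma ell2_norm_nth_le: "norm (ell2_nth f i) \<le> norm f"
  using ell2_sum_le_norm[of "{i}" f] by (simp add: power2_le_iff_abs_le)

lemma ell2_norm_leI:
  assumes "\<And>F. finite F \<Longrightarrow> (\<Sum>i\<in>F. (norm (ell2_nth f i))\<^sup>2) \<le> C\<^sup>2" "0 \<le> C"
  shows "norm f \<le> C"
proof -
  have "(norm f)\<^sup>2 \<le> C\<^sup>2"
    unfolding ell2_norm_square by (rule infsum_le_finite_sums) (auto simp: ell2_summable assms)
  then show ?thesis using assms(2) by (simp add: power2_le_iff_abs_le)
qed

instance ell2 :: (type, chilbert_space) chilbert_space
proof
  fix X :: "nat \<Rightarrow> ('a, 'b) ell2"
  assume X: "Cauchy X"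
  have "Cauchy (\<lambda>m. ell2_nth (X m) i)" for i
  proof (rule metric_CauchyI)
    fix e :: real assume "0 < e"
    then obtain M where "\<forall>m\<ge>M. \<forall>n\<ge>M. dist (X m) (X n) < e" using metric_CauchyD[OF X] by blast
    moreover have "dist (ell2_nth (X m) i) (ell2_nth (X n) i) \<le> dist (X m) (X n)" for m n
      using ell2_norm_nth_le[of "X m - X n" i] by (simp add: dist_norm minus_ell2.rep_eq)
    ultimately show "\<exists>M. \<forall>m\<ge>M. \<forall>n\<ge>M. dist (ell2_nth (X m) i) (ell2_nth (X n) i) < e"
      by (meson le_less_trans)
  qed
  then have "\<forall>i. \<exists>l. (\<lambda>m. ell2_nth (X m) i) \<longlonglongrightarrow> l"
    using Cauchy_convergent convergent_def by blast
  then obtain l where l: "\<And>i. (\<lambda>m. ell2_nth (X m) i) \<longlonglongrightarrow> l i" by metis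
  have tail: "\<exists>M. \<forall>m\<ge>M. \<forall>F. finite F \<longrightarrow> (\<Sum>i\<in>F. (norm (ell2_nth (X m) i - l i))\<^sup>2) \<le> e\<^sup>2"
    if "0 < e" for e :: real
  proof -
    obtain M where M: "\<forall>m\<ge>M. \<forall>n\<ge>M. dist (X m) (X n) < e"
      using metric_CauchyD[OF X \<open>0 < e\<close>] by blast
    have "(\<Sum>i\<in>F. (norm (ell2_nth (X m) i - l i))\<^sup>2) \<le> e\<^sup>2" if "m \<ge> M" "finite F" for m F
    proof (rule LIMSEQ_le_const2)
      show "(\<lambda>n. \<Sum>i\<in>F. (norm (ell2_nth (X m) i - ell2_nth (X n) i))\<^sup>2)
          \<longlonglongrightarrow> (\<Sum>i\<in>F. (norm (ell2_nth (X m) i - l i))\<^sup>2)"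
        by (intro tendsto_intros l)
      have "(\<Sum>i\<in>F. (norm (ell2_nth (X m) i - ell2_nth (X n) i))\<^sup>2) \<le> e\<^sup>2" if "n \<ge> M" for n
      proof -
        have "(\<Sum>i\<in>F. (norm (ell2_nth (X m) i - ell2_nth (X n) i))\<^sup>2) \<le> (norm (X m - X n))\<^sup>2"
          using ell2_sum_le_norm[OF \<open>finite F\<close>, of "X m - X n"] by (simp add: minus_ell2.rep_eq)
        also have "\<dots> \<le> e\<^sup>2"
          using M \<open>m \<ge> M\<close> \<open>n \<ge> M\<close> by (intro power_mono) (auto simp: dist_norm less_imp_le)
        finally show ?thesis .
      qed
      then show "\<exists>N. \<forall>n\<ge>N. (\<Sum>i\<in>F. (norm (ell2_nth (X m) i - ell2_nth (X n) i))\<^sup>2) \<le> e\<^sup>2" by blast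
    qed
    then show ?thesis by blast
  qed
  obtain M where M: "\<And>F. finite F \<Longrightarrow> (\<Sum>i\<in>F. (norm (ell2_nth (X M) i - l i))\<^sup>2) \<le> 1\<^sup>2"
    using tail[of 1] by auto
  have "(\<lambda>i. (norm (ell2_nth (X M) i - l i))\<^sup>2) summable_on UNIV"
    using M by (intro nonneg_bdd_above_summable_on bdd_aboveI[of _ 1]) auto
  then have "(\<lambda>i. (norm (l i - ell2_nth (X M) i))\<^sup>2) summable_on UNIV"
    by (simp add: norm_minus_commute)
  from square_summable_add[OF this ell2_summable[of "X M"]]
  have sl: "(\<lambda>i. (norm (l i))\<^sup>2) summable_on UNIV" by simp
  have nth_l: "ell2_nth (Abs_ell2 l) = l"
    by (rule Abs_ell2_inverse) (simp add: sl)
  have "X \<longlonglongrightarrow> Abs_ell2 l"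
  proof (rule metric_LIMSEQ_I)
    fix e :: real assume "0 < e"
    then have "0 < e / 2" by simp
    from tail[OF this] obtain M where
      M: "\<And>m F. m \<ge> M \<Longrightarrow> finite F \<Longrightarrow> (\<Sum>i\<in>F. (norm (ell2_nth (X m) i - l i))\<^sup>2) \<le> (e / 2)\<^sup>2"
      by blast
    have "dist (X m) (Abs_ell2 l) < e" if "m \<ge> M" for m
    proof -
      have "norm (X m - Abs_ell2 l) \<le> e / 2"
        using M[OF that] \<open>0 < e\<close> by (intro ell2_norm_leI) (auto simp: minus_ell2.rep_eq nth_l)
      then show ?thesis using \<open>0 < e\<close> by (simp add: dist_norm)
    qed
    then show "\<exists>M. \<forall>m\<ge>M. dist (X m) (Abs_ell2 l) < e" by blast
  qed
  then show "convergent X" by (rule convergentI)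
qed

section \<open>The full Fock space and its tensor product with a Hilbert space\<close>

text \<open>
  The letters \<open>1, \<dots>, n\<close> are the elements, in increasing order, of a finite linearly ordered
  type \<open>'n\<close> with \<open>n = CARD('n)\<close>; words are lists of letters. The full Fock space is the space of
  square-summable families of scalars indexed by words, and its Hilbert space tensor product with
  \<open>'e\<close> is the space of square-summable families in \<open>'e\<close> indexed by words: see
  \<open>cinner_tensor\<close> and \<open>closure_tensor\<close> below.
\<close>

type_synonym 'n fock = "('n list, complex) ell2"
type_synonym ('n, 'e) fock_tensor = "('n list, 'e) ell2"

lift_definition tensor :: "('i, complex) ell2 \<Rightarrow> 'e::complex_inner \<Rightarrow> ('i, 'e) ell2" (infixr "\<otimes>" 70)
  is "\<lambda>f \<eta> \<mu>. f \<mu> *\<^sub>C \<eta>"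
  by (auto simp: power_mult_distrib intro: summable_on_cmult_left)

lift_definition word_basis :: "'n list \<Rightarrow> 'n fock" is "\<lambda>\<mu> \<nu>. if \<nu> = \<mu> then 1 else 0"
  subgoal for \<mu> by (rule finite_nonzero_values_imp_summable_on) (rule finite_subset[of _ "{\<mu>}"], auto)
  done

abbreviation vacuum :: "'n fock" ("\<Omega>")
  where "\<Omega> \<equiv> word_basis []"

text \<open>Left tensoring by \<open>e\<^sub>\<mu>\<close>: the extension of \<open>e\<^sub>\<nu> \<otimes> \<eta> \<mapsto> e\<^sub>\<mu>\<^sub>\<nu> \<otimes> \<eta>\<close>, see \<open>left_tensor_tensor\<close>.\<close>

lift_definition left_tensor ::
    "'n list \<Rightarrow> ('n, 'e::complex_inner) fock_tensor \<Rightarrow> ('n, 'e) fock_tensor"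
  is "\<lambda>\<mu> f \<nu>. if take (length \<mu>) \<nu> = \<mu> then f (drop (length \<mu>) \<nu>) else 0"
  subgoal premises prems for \<mu> f
  proof -
    have inj: "inj ((@) \<mu>)" by (simp add: inj_def)
    have "((\<lambda>\<nu>. (norm (if take (length \<mu>) \<nu> = \<mu> then f (drop (length \<mu>) \<nu>) else 0))\<^sup>2) \<circ> (@) \<mu>)
        summable_on UNIV"
      using prems by (simp add: o_def)
    then have "(\<lambda>\<nu>. (norm (if take (length \<mu>) \<nu> = \<mu> then f (drop (length \<mu>) \<nu>) else 0))\<^sup>2)
        summable_on range ((@) \<mu>)"
      by (simp add: summable_on_reindex[OF inj])
    then show ?thesis
      by (rule summable_on_cong_neutral[THEN iffD1, rotated -1])
        (auto, metis append_take_drop_id rangeI)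
  qed
  done

lemma left_tensor_tensor: "left_tensor \<mu> (word_basis \<nu> \<otimes> \<eta>) = word_basis (\<mu> @ \<nu>) \<otimes> \<eta>"
  by (rule ell2_eqI)
    (auto simp: left_tensor.rep_eq tensor.rep_eq word_basis.rep_eq,
      metis append_take_drop_id)

lemma left_tensor_Nil [simp]: "left_tensor [] f = f"
  by (rule ell2_eqI) (simp add: left_tensor.rep_eq)

lemma cinner_word_basis: "cinner (word_basis \<mu>) (word_basis \<nu>) = (if \<mu> = \<nu> then 1 else 0)"
proof -
  have "cinner (word_basis \<mu>) (word_basis \<nu>)
      = (\<Sum>\<^sub>\<infinity>\<rho>. cinner (ell2_nth (word_basis \<mu>) \<rho>) (ell2_nth (word_basis \<nu>) \<rho>))"
    by (rule cinner_ell2_def)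
  also have "\<dots> = (\<Sum>\<^sub>\<infinity>\<rho>\<in>{\<mu>}. if \<mu> = \<nu> then 1 else 0)"
    by (rule infsum_cong_neutral) (auto simp: word_basis.rep_eq cinner_complex_def)
  finally show ?thesis by simp
qed

lemma cinner_scaleC_right: "cinner x (c *\<^sub>C y) = cnj c * cinner x (y :: 'a::complex_inner)"
  by (metis cinner_commute cinner_scaleC_left complex_cnj_mult)

lemma cinner_tensor: "cinner (f \<otimes> \<eta>) (g \<otimes> \<zeta>) = cinner f g * cinner \<eta> \<zeta>"
  by (simp add: cinner_ell2_def tensor.rep_eq cinner_scaleC_left cinner_scaleC_right
      cinner_complex_def infsum_cmult_right'[symmetric] ac_simps)

lemma ell2_nth_sum: "finite F \<Longrightarrow> ell2_nth (\<Sum>x\<in>F. f x) i = (\<Sum>x\<in>F. ell2_nth (f x) i)"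
  by (induction rule: finite_induct) (auto simp: zero_ell2.rep_eq plus_ell2.rep_eq)

lemma closure_tensor:
  "closure (cspan {word_basis \<mu> \<otimes> \<eta> | \<mu> \<eta>. True}) = (UNIV :: ('n, 'e::complex_inner) fock_tensor set)"
proof -
  have "x \<in> closure (cspan {word_basis \<mu> \<otimes> \<eta> | \<mu> \<eta>. True})" for x :: "('n, 'e) fock_tensor"
    unfolding closure_approachable
  proof (intro allI impI)
    fix e :: real assume "0 < e"
    have s: "((\<lambda>i. (norm (ell2_nth x i))\<^sup>2) has_sum (norm x)\<^sup>2) UNIV"
      unfolding ell2_norm_square by (rule has_sum_infsum) (rule ell2_summable)
    then obtain F where F: "finite F"
      "dist (\<Sum>i\<in>F. (norm (ell2_nth x i))\<^sup>2) ((norm x)\<^sup>2) < (e / 2)\<^sup>2"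
      using \<open>0 < e\<close> tendstoD[OF s[unfolded has_sum_def], of "(e / 2)\<^sup>2"]
      by (auto simp: eventually_finite_subsets_at_top)
    let ?y = "\<Sum>\<mu>\<in>F. word_basis \<mu> \<otimes> ell2_nth x \<mu>"
    have y: "ell2_nth ?y i = (if i \<in> F then ell2_nth x i else 0)" for i
    proof -
      have "ell2_nth ?y i = (\<Sum>\<mu>\<in>F. if i = \<mu> then ell2_nth x \<mu> else 0)"
        unfolding ell2_nth_sum[OF F(1)]
        by (rule sum.cong) (auto simp: tensor.rep_eq word_basis.rep_eq)
      then show ?thesis using F(1) by simp
    qed
    have "norm (?y - x) \<le> e / 2"
    proof (rule ell2_norm_leI)
      fix G :: "'n list set" assume G: "finite G"
      have "(\<Sum>i\<in>G. (norm (ell2_nth (?y - x) i))\<^sup>2) = (\<Sum>i\<in>G - F. (norm (ell2_nth x i))\<^sup>2)"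
        by (rule sum.mono_neutral_cong_right) (auto simp: G minus_ell2.rep_eq y)
      also have "\<dots> = (\<Sum>i\<in>G \<union> F. (norm (ell2_nth x i))\<^sup>2) - (\<Sum>i\<in>F. (norm (ell2_nth x i))\<^sup>2)"
        using sum.subset_diff[of F "G \<union> F" "\<lambda>i. (norm (ell2_nth x i))\<^sup>2"] G F(1)
        by (simp add: Un_Diff)
      also have "\<dots> \<le> (e / 2)\<^sup>2"
        using ell2_sum_le_norm[of "G \<union> F" x] G F by (simp add: dist_real_def)
      finally show "(\<Sum>i\<in>G. (norm (ell2_nth (?y - x) i))\<^sup>2) \<le> (e / 2)\<^sup>2" .
    qed (use \<open>0 < e\<close> in simp)
    moreover have "?y \<in> cspan {word_basis \<mu> \<otimes> \<eta> | \<mu> \<eta>. True}"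
      by (intro complex_vector.span_sum complex_vector.span_base) blast
    ultimately show "\<exists>y\<in>cspan {word_basis \<mu> \<otimes> \<eta> | \<mu> \<eta>. True}. dist y x < e"
      using \<open>0 < e\<close> by (intro bexI[of _ ?y]) (auto simp: dist_norm)
  qed
  then show ?thesis by blast
qed

section \<open>The odometer map\<close>

definition first_letter :: "'n::{finite, linorder}"
  where "first_letter = Min UNIV"

definition last_letter :: "'n::{finite, linorder}"
  where "last_letter = Max UNIV"

text \<open>The letter \<open>j + 1\<close>; only used for \<open>j \<noteq> last_letter\<close>.\<close>

definition next_letter :: "'n::{finite, linorder} \<Rightarrow> 'n"
  where "next_letter j = Min {i. j < i}"

text \<open>
  Positions in lists are counted from 0: the \<open>k\<close> below is the number of leading letters \<open>n\<close> of
  \<open>\<mu>\<close>, one less than the smallest index of a letter \<open>\<noteq> n\<close> when letters are numbered from 1. For a general bounded \<open>L\<close>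
  there may be no bounded \<open>W\<close> with these properties.
\<close>

definition is_odometer_map ::
    "('e::chilbert_space \<Rightarrow> ('n::{finite, linorder}, 'e) fock_tensor)
      \<Rightarrow> (('n, 'e) fock_tensor \<Rightarrow> ('n, 'e) fock_tensor) \<Rightarrow> bool"
  where "is_odometer_map L W \<longleftrightarrow>
    bounded_clinear W \<and>
    (\<forall>\<eta>. W (\<Omega> \<otimes> \<eta>) = L \<eta>) \<and>
    (\<forall>m\<ge>1. \<forall>\<eta>. W (word_basis (replicate m last_letter) \<otimes> \<eta>)
      = left_tensor (replicate m first_letter) (L \<eta>)) \<and>
    (\<forall>\<mu> \<eta>. (\<exists>j\<in>set \<mu>. j \<noteq> last_letter) \<longrightarrow>
      (let k = (LEAST k. k < length \<mu> \<and> \<mu> ! k \<noteq> last_letter)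
       in W (word_basis \<mu> \<otimes> \<eta>)
         = word_basis (replicate k first_letter @ next_letter (\<mu> ! k) # drop (Suc k) \<mu>) \<otimes> \<eta>))"

definition odometer_map ::
    "('e::chilbert_space \<Rightarrow> ('n::{finite, linorder}, 'e) fock_tensor)
      \<Rightarrow> ('n, 'e) fock_tensor \<Rightarrow> ('n, 'e) fock_tensor"
  where "odometer_map L = (THE W. is_odometer_map L W)"

text \<open>The space \<open>\<E>\<^sub>L\<close>, with orthogonality written out.\<close>

definition defect_space ::
    "('e::chilbert_space \<Rightarrow> ('n::{finite, linorder}, 'e) fock_tensor) \<Rightarrow> ('n, 'e) fock_tensor set"
  where "defect_space L =
    {f \<in> closure (cspan {word_basis (replicate m first_letter) \<otimes> \<eta> | m \<eta>. True}).
      \<forall>g \<in> closure (cspan {left_tensor (replicate p first_letter) (L \<zeta>) | p \<zeta>. 1 \<le> p}).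
        cinner f g = 0}"

end

theory Submission
  imports Defs
begin

text \<open>
  The odometer acts on words as the successor map of the \<open>n\<close>-adic odometer, a bijection from the
  words with a letter \<open>\<noteq> n\<close> onto the words with a letter \<open>\<noteq> 1\<close>; there \<open>W\<^sub>L\<close> is isometric. On the
  remaining words \<open>e\<^sub>n\<^sup>m\<close>, the condition on the range of \<open>L\<close> says that the vectors \<open>e\<^sub>1\<^sup>m \<otimes> L \<eta>\<^sub>m\<close> are
  supported on words in the letter \<open>1\<close> and mutually orthogonal, so that
  \<open>\<parallel>\<Sum>\<^sub>m e\<^sub>1\<^sup>m \<otimes> L \<eta>\<^sub>m\<parallel>\<^sup>2 = \<Sum>\<^sub>m \<parallel>L \<eta>\<^sub>m\<parallel>\<^sup>2 \<le> \<parallel>L\<parallel>\<^sup>2 \<Sum>\<^sub>m \<parallel>\<eta>\<^sub>m\<parallel>\<^sup>2\<close>.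
  The coefficients of \<open>W\<^sub>L f\<close> are finite sums, so \<open>W\<^sub>L\<close> can be defined coefficientwise; the estimate
  on finite sets of words then gives both its existence and the bound for its norm.
\<close>

section \<open>The odometer on words\<close>

lemma next_letter_gt: "j \<noteq> last_letter \<Longrightarrow> j < next_letter j"
  for j :: "'n::{finite, linorder}"
proof -
  assume "j \<noteq> last_letter"
  then have "j < last_letter"
    unfolding last_letter_def by (simp add: less_le)
  then have "Min {i. j < i} \<in> {i. j < i}"
    by (intro Min_in) auto
  then show ?thesis by (simp add: next_letter_def)
qed

lemma next_letter_le: "j < i \<Longrightarrow> next_letter j \<le> i"
  for i j :: "'n::{finite, linorder}"
  unfolding next_letter_def by (rule Min_le) auto

definition prev_letter :: "'n::{finite, linorder} \<Rightarrow> 'n"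
  where "prev_letter j = Max {i. i < j}"

lemma prev_letter_lt: "j \<noteq> first_letter \<Longrightarrow> prev_letter j < j"
  for j :: "'n::{finite, linorder}"
proof -
  assume "j \<noteq> first_letter"
  then have "first_letter < j"
    unfolding first_letter_def by (simp add: less_le)
  then have "Max {i. i < j} \<in> {i. i < j}"
    by (intro Max_in) auto
  then show ?thesis by (simp add: prev_letter_def)
qed

lemma le_prev_letter: "i < j \<Longrightarrow> i \<le> prev_letter j"
  for i j :: "'n::{finite, linorder}"
  unfolding prev_letter_def by (rule Max_ge) auto

lemma first_letter_le: "first_letter \<le> (j :: 'n::{finite, linorder})"
  by (simp add: first_letter_def)

lemma le_last_letter: "(j :: 'n::{finite, linorder}) \<le> last_letter"
  by (simp add: last_letter_def)

lemma next_letter_neq_first: "j \<noteq> last_letter \<Longrightarrow> next_letter j \<noteq> first_letter"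
  using next_letter_gt first_letter_le leD by metis

lemma prev_letter_neq_last: "j \<noteq> first_letter \<Longrightarrow> prev_letter j \<noteq> last_letter"
  using prev_letter_lt le_last_letter leD by metis

lemma prev_next_letter: "j \<noteq> last_letter \<Longrightarrow> prev_letter (next_letter j) = j"
  using next_letter_gt[of j] next_letter_neq_first[of j] prev_letter_lt[of "next_letter j"]
    le_prev_letter[of j "next_letter j"] next_letter_le[of j "prev_letter (next_letter j)"]
  by fastforce

lemma next_prev_letter: "j \<noteq> first_letter \<Longrightarrow> next_letter (prev_letter j) = j"
  using prev_letter_lt[of j] prev_letter_neq_last[of j] next_letter_gt[of "prev_letter j"]
    next_letter_le[of "prev_letter j" j] le_prev_letter[of "next_letter (prev_letter j)" j]
  by fastforce

text \<open>Adding one with carry, as a recursion so that its inverse \<open>word_pred\<close> can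
  be handled by induction. On a word with all letters n the carry runs off the end and leaves all
  letters 1; there the odometer acts through \<open>L\<close> instead.\<close>

fun word_succ :: "'n::{finite, linorder} list \<Rightarrow> 'n list" where
  "word_succ [] = []"
| "word_succ (j # \<mu>) =
    (if j = last_letter then first_letter # word_succ \<mu> else next_letter j # \<mu>)"

fun word_pred :: "'n::{finite, linorder} list \<Rightarrow> 'n list" where
  "word_pred [] = []"
| "word_pred (j # \<mu>) =
    (if j = first_letter then last_letter # word_pred \<mu> else prev_letter j # \<mu>)"

lemma word_pred_succ: "\<exists>j\<in>set \<mu>. j \<noteq> last_letter \<Longrightarrow> word_pred (word_succ \<mu>) = \<mu>"
  by (induction \<mu>) (auto simp: prev_next_letter next_letter_neq_first)

lemma word_succ_pred: "\<exists>j\<in>set \<nu>. j \<noteq> first_letter \<Longrightarrow> word_succ (word_pred \<nu>) = \<nu>"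
  by (induction \<nu>) (auto simp: next_prev_letter prev_letter_neq_last)

lemma word_succ_neq_first:
  "\<exists>j\<in>set \<mu>. j \<noteq> last_letter \<Longrightarrow> \<exists>j\<in>set (word_succ \<mu>). j \<noteq> first_letter"
  by (induction \<mu>) (auto simp: next_letter_neq_first)

lemma word_pred_neq_last:
  "\<exists>j\<in>set \<nu>. j \<noteq> first_letter \<Longrightarrow> \<exists>j\<in>set (word_pred \<nu>). j \<noteq> last_letter"
  by (induction \<nu>) (auto simp: prev_letter_neq_last)

text \<open>Links the recursion to the \<open>LEAST\<close> form in \<open>is_odometer_map\<close>:
  a leading n shifts the least position by one.\<close>

lemma word_succ_Least:
  assumes "\<exists>j\<in>set \<mu>. j \<noteq> last_letter"
  shows "word_succ \<mu> = (let k = (LEAST k. k < length \<mu> \<and> \<mu> ! k \<noteq> last_letter)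
    in replicate k first_letter @ next_letter (\<mu> ! k) # drop (Suc k) \<mu>)"
  using assms
proof (induction \<mu>)
  case (Cons j \<mu>)
  let ?P = "\<lambda>\<mu> k. k < length \<mu> \<and> \<mu> ! k \<noteq> last_letter"
  show ?case
  proof (cases "j = last_letter")
    case True
    with Cons.prems have *: "\<exists>j\<in>set \<mu>. j \<noteq> last_letter" by auto
    then obtain k where "?P \<mu> k" by (auto simp: in_set_conv_nth)
    then have "Least (?P (j # \<mu>)) = Suc (LEAST k. ?P (j # \<mu>) (Suc k))"
      by (intro Least_Suc[of _ "Suc k"]) (auto simp: True)
    then have "Least (?P (j # \<mu>)) = Suc (Least (?P \<mu>))" by simp
    with Cons.IH[OF *] True show ?thesis by (simp add: Let_def)
  next
    case False
    then have "Least (?P (j # \<mu>)) = 0" by (intro Least_eq_0) auto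
    with False show ?thesis by (simp add: Let_def)
  qed
qed simp

lemma word_neq_replicate: "\<exists>j\<in>set \<mu>. j \<noteq> a \<Longrightarrow> \<mu> \<noteq> replicate m a"
  by auto

lemma word_eq_replicate: "\<not> (\<exists>j\<in>set \<mu>. j \<noteq> a) \<Longrightarrow> \<mu> = replicate (length \<mu>) a"
  by (simp add: replicate_length_same)

section \<open>Square-summable families and left tensoring\<close>

lemma ell2_nth_tensor_basis:
  "ell2_nth (word_basis \<mu> \<otimes> \<eta>) \<nu> = (if \<nu> = \<mu> then \<eta> else 0)"
  by (simp add: tensor.rep_eq word_basis.rep_eq)

lemma norm_tensor_basis: "norm (word_basis \<mu> \<otimes> \<eta>) = norm (\<eta> :: 'e::complex_inner)"
proof -
  have "complex_of_real ((norm (word_basis \<mu> \<otimes> \<eta>))\<^sup>2) = complex_of_real ((norm \<eta>)\<^sup>2)"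
    by (simp only: cinner_self[symmetric] cinner_tensor cinner_word_basis) simp
  then have "(norm (word_basis \<mu> \<otimes> \<eta>))\<^sup>2 = (norm \<eta>)\<^sup>2"
    by (simp only: of_real_eq_iff)
  then show ?thesis by simp
qed

lemma bounded_linear_ell2_nth: "bounded_linear (\<lambda>f. ell2_nth f i)"
  by (rule bounded_linear_intro[of _ 1])
    (auto simp: plus_ell2.rep_eq scaleR_ell2.rep_eq ell2_norm_nth_le)

text \<open>The coefficient at \<open>i\<close> is bounded and complex linear, so its kernel is a
  closed subspace.\<close>

lemma ell2_nth_closure_cspan_eq_0:
  assumes "f \<in> closure (cspan S)" "\<And>g. g \<in> S \<Longrightarrow> ell2_nth g i = 0"
  shows "ell2_nth f i = 0"
proof -
  have "ell2_nth g i = 0" if "g \<in> cspan S" for g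
    using that
    by (induction rule: complex_vector.span_induct_alt)
      (auto simp: zero_ell2.rep_eq plus_ell2.rep_eq scaleC_ell2.rep_eq assms(2))
  moreover have "closed {f. ell2_nth f i = 0}"
    by (intro closed_Collect_eq continuous_on_const linear_continuous_on bounded_linear_ell2_nth)
  ultimately have "closure (cspan S) \<subseteq> {f. ell2_nth f i = 0}"
    by (intro closure_minimal) auto
  with assms(1) show ?thesis by auto
qed

lemma left_tensor_append: "left_tensor (\<mu> @ \<nu>) f = left_tensor \<mu> (left_tensor \<nu> f)"
proof (rule ell2_eqI)
  fix \<rho>
  have "take (length \<mu> + length \<nu>) \<rho> = \<mu> @ \<nu> \<longleftrightarrow>
      take (length \<mu>) \<rho> = \<mu> \<and> take (length \<nu>) (drop (length \<mu>) \<rho>) = \<nu>"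
    by (auto simp: take_add append_eq_append_conv_if)
      (metis append_eq_conv_conj append_take_drop_id length_append length_take min.absorb_iff2
        min.commute min_def take_add)+
  then show "ell2_nth (left_tensor (\<mu> @ \<nu>) f) \<rho> = ell2_nth (left_tensor \<mu> (left_tensor \<nu> f)) \<rho>"
    by (simp add: left_tensor.rep_eq drop_drop add.commute)
qed

text \<open>Prefixing words by \<open>\<mu>\<close> is injective, so coefficients are moved without
  collision and the sum can be reindexed.\<close>

lemma cinner_left_tensor: "cinner (left_tensor \<mu> f) (left_tensor \<mu> g) = cinner f g"
proof -
  have "cinner (left_tensor \<mu> f) (left_tensor \<mu> g)
      = (\<Sum>\<^sub>\<infinity>\<rho>\<in>range ((@) \<mu>). cinner (ell2_nth (left_tensor \<mu> f) \<rho>) (ell2_nth (left_tensor \<mu> g) \<rho>))"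
    unfolding cinner_ell2_def
  proof (rule infsum_cong_neutral)
    fix \<rho> assume "\<rho> \<in> UNIV - range ((@) \<mu>)"
    then have "take (length \<mu>) \<rho> \<noteq> \<mu>" by (metis DiffD2 append_take_drop_id rangeI)
    then show "cinner (ell2_nth (left_tensor \<mu> f) \<rho>) (ell2_nth (left_tensor \<mu> g) \<rho>) = 0"
      \<comment> \<open>Homogeneity with the scalar 0 gives \<open>cinner 0 y = 0\<close>.\<close>
      using cinner_scaleC_left[of 0 0] by (simp add: left_tensor.rep_eq)
  qed auto
  also have "\<dots> = cinner f g"
    by (subst infsum_reindex) (auto simp: inj_def o_def left_tensor.rep_eq cinner_ell2_def)
  finally show ?thesis .
qed

lemma norm_left_tensor: "norm (left_tensor \<mu> f) = norm f"
proof -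
  have "(norm (left_tensor \<mu> f))\<^sup>2 = (norm f)\<^sup>2"
    using cinner_left_tensor[of \<mu> f f] by (simp only: cinner_self of_real_eq_iff)
  then show ?thesis by simp
qed

text \<open>The set where \<open>V\<close> and \<open>W\<close> agree is closed and contains a span
  that is dense by \<open>closure_tensor\<close>.\<close>

lemma clinear_eq_on_basis:
  fixes V W :: "('n, 'e::complex_inner) fock_tensor \<Rightarrow> 'b::complex_inner"
  assumes V: "bounded_clinear V" and W: "bounded_clinear W"
    and eq: "\<And>\<mu> \<eta>. V (word_basis \<mu> \<otimes> \<eta>) = W (word_basis \<mu> \<otimes> \<eta>)"
  shows "V = W"
proof -
  interpret V: bounded_linear V using V by (simp add: bounded_clinear_def)
  interpret W: bounded_linear W using W by (simp add: bounded_clinear_def)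
  have scale: "V (c *\<^sub>C x) = c *\<^sub>C V x" "W (c *\<^sub>C x) = c *\<^sub>C W x" for c x
    using V W by (auto simp: bounded_clinear_def)
  have "V f = W f" if "f \<in> cspan {word_basis \<mu> \<otimes> \<eta> | \<mu> \<eta>. True}" for f
    using that
    by (induction rule: complex_vector.span_induct_alt)
      (auto simp: V.zero W.zero V.add W.add scale eq)
  moreover have "closed {f. V f = W f}"
    by (intro closed_Collect_eq V.continuous_on W.continuous_on continuous_on_id)
  ultimately have "closure (cspan {word_basis \<mu> \<otimes> \<eta> | \<mu> \<eta>. True}) \<subseteq> {f. V f = W f}"
    by (intro closure_minimal) auto
  then show ?thesis unfolding closure_tensor by auto
qed

section \<open>The defect space\<close>

lemma defect_space_support:
  assumes "f \<in> defect_space L" "\<exists>j\<in>set \<nu>. j \<noteq> first_letter"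
  shows "ell2_nth f \<nu> = 0"
proof (rule ell2_nth_closure_cspan_eq_0)
  show "f \<in> closure (cspan {word_basis (replicate m first_letter) \<otimes> \<eta> | m \<eta>. True})"
    using assms(1) by (simp add: defect_space_def)
qed (use word_neq_replicate[OF assms(2)] in \<open>auto simp: ell2_nth_tensor_basis\<close>)

lemma defect_space_orthogonal:
  assumes "f \<in> defect_space L" "1 \<le> p"
  shows "cinner f (left_tensor (replicate p first_letter) (L \<zeta>)) = 0"
proof -
  have "left_tensor (replicate p first_letter) (L \<zeta>)
      \<in> closure (cspan {left_tensor (replicate p first_letter) (L \<zeta>) | p \<zeta>. 1 \<le> p})"
    using assms(2) by (intro closure_subset[THEN subsetD] complex_vector.span_base) auto
  then show ?thesis using assms(1) by (simp add: defect_space_def)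
qed

text \<open>For i < j the common prefix e_1^i cancels, leaving \<open>L \<eta>\<close> against
  e_1^(j-i) tensored with \<open>L \<zeta>\<close>. Since j - i >= 1, the orthogonality in
  \<open>defect_space\<close> applies.\<close>

lemma inner_left_tensor_symbol:
  fixes L :: "'e::chilbert_space \<Rightarrow> ('n::{finite, linorder}, 'e) fock_tensor"
  assumes "range L \<subseteq> defect_space L" "i \<noteq> j"
  shows "inner (left_tensor (replicate i first_letter) (L \<eta>))
    (left_tensor (replicate j first_letter) (L \<zeta>)) = 0"
proof -
  have *: "inner (left_tensor (replicate i first_letter) (L \<eta>))
      (left_tensor (replicate j first_letter) (L \<zeta>)) = 0" if "i < j" for i j \<eta> \<zeta>
  proof -
    have split: "replicate j first_letter
        = replicate i first_letter @ replicate (j - i) (first_letter :: 'n)"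
      using that by (simp add: replicate_add[symmetric])
    have "cinner (left_tensor (replicate i first_letter) (L \<eta>))
        (left_tensor (replicate j first_letter) (L \<zeta>))
        = cinner (L \<eta>) (left_tensor (replicate (j - i) first_letter) (L \<zeta>))"
      by (subst split) (simp only: left_tensor_append cinner_left_tensor)
    also have "\<dots> = 0"
      using assms(1) that by (intro defect_space_orthogonal) auto
    finally show ?thesis by (simp flip: Re_cinner)
  qed
  show ?thesis
    using *[of i j \<eta> \<zeta>] *[of j i \<zeta> \<eta>] assms(2)
    by (cases i j rule: linorder_cases) (auto simp: inner_commute)
qed

lemma norm_sum_left_tensor:
  fixes L :: "'e::chilbert_space \<Rightarrow> ('n::{finite, linorder}, 'e) fock_tensor"
  assumes "range L \<subseteq> defect_space L" "finite I"
  shows "(norm (\<Sum>i\<in>I. left_tensor (replicate i first_letter) (L (\<eta> i))))\<^sup>2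
    = (\<Sum>i\<in>I. (norm (L (\<eta> i)))\<^sup>2)"
  using norm_sum_Pythagorean[of I "\<lambda>i. left_tensor (replicate i first_letter) (L (\<eta> i))"]
    assms inner_left_tensor_symbol[OF assms(1)]
  by (simp add: pairwise_def orthogonal_def norm_left_tensor)

section \<open>The odometer map\<close>

text \<open>
  At \<open>1\<^sup>k\<close> this is the coefficient of \<open>\<Sum>\<^sub>i e\<^sub>1\<^sup>i \<otimes> L \<eta>\<^sub>i\<close>, with \<open>\<eta>\<^sub>i\<close> the coefficient of \<open>f\<close> at \<open>n\<^sup>i\<close>: the
  terms with \<open>i > k\<close> vanish there.
\<close>

definition odometer_coeff ::
    "('e::chilbert_space \<Rightarrow> ('n::{finite, linorder}, 'e) fock_tensor)
      \<Rightarrow> ('n, 'e) fock_tensor \<Rightarrow> 'n list \<Rightarrow> 'e"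
  where "odometer_coeff L f \<nu> =
    (if \<exists>j\<in>set \<nu>. j \<noteq> first_letter then ell2_nth f (word_pred \<nu>)
     else \<Sum>i\<le>length \<nu>. ell2_nth (L (ell2_nth f (replicate i last_letter))) (drop i \<nu>))"

text \<open>Terms beyond \<open>length \<nu>\<close> do not contribute at \<open>\<nu>\<close>, so a
  single \<open>N\<close> can serve finitely many words at once.\<close>

lemma odometer_coeff_eq_sum:
  assumes "\<not> (\<exists>j\<in>set \<nu>. j \<noteq> first_letter)" "length \<nu> < N"
  shows "odometer_coeff L f \<nu> = ell2_nth
    (\<Sum>i<N. left_tensor (replicate i first_letter) (L (ell2_nth f (replicate i last_letter)))) \<nu>"
proof -
  have take: "take i \<nu> = replicate i first_letter \<longleftrightarrow> i \<le> length \<nu>" for i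
  proof
    assume "i \<le> length \<nu>"
    moreover have "\<nu> = replicate (length \<nu>) first_letter" using assms(1) by (rule word_eq_replicate)
    ultimately show "take i \<nu> = replicate i first_letter"
      by (metis min.absorb1 take_replicate)
  qed (metis length_replicate length_take min.cobounded1)
  have "ell2_nth (\<Sum>i<N. left_tensor (replicate i first_letter)
      (L (ell2_nth f (replicate i last_letter)))) \<nu>
    = (\<Sum>i<N. if i \<le> length \<nu>
        then ell2_nth (L (ell2_nth f (replicate i last_letter))) (drop i \<nu>) else 0)"
    by (simp add: ell2_nth_sum left_tensor.rep_eq take cong: if_cong)
  also have "\<dots> = (\<Sum>i\<le>length \<nu>. ell2_nth (L (ell2_nth f (replicate i last_letter))) (drop i \<nu>))"
    using assms(2) by (intro sum.mono_neutral_cong_right) auto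
  finally show ?thesis using assms(1) by (simp add: odometer_coeff_def)
qed

text \<open>Stated for finite sets because square-summability is still to be derived from it. Words
  with a letter other than 1 read \<open>f\<close> at words with a letter other than n; the
  remaining ones read it, through \<open>L\<close>, at powers of n. These are disjoint sets of
  coefficients of \<open>f\<close>.\<close>

lemma sum_odometer_coeff_le:
  fixes L :: "'e::chilbert_space \<Rightarrow> ('n::{finite, linorder}, 'e) fock_tensor"
  assumes L: "bounded_linear L" "range L \<subseteq> defect_space L" and F: "finite F"
  shows "(\<Sum>\<nu>\<in>F. (norm (odometer_coeff L f \<nu>))\<^sup>2) \<le> (max 1 (onorm L) * norm f)\<^sup>2"
proof -
  define C where "C = max 1 (onorm L)"
  have C: "1 \<le> C" "onorm L \<le> C" "1 \<le> C\<^sup>2" by (auto simp: C_def)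
  define G where "G = {\<nu>\<in>F. \<exists>j\<in>set \<nu>. j \<noteq> first_letter}"
  \<comment> \<open>Exceeds the length of every word in \<open>F\<close>; the inserted 0 covers
    empty \<open>F\<close>.\<close>
  define N where "N = Suc (Max (insert 0 (length ` F)))"
  define S where
    "S = (\<Sum>i<N. left_tensor (replicate i first_letter) (L (ell2_nth f (replicate i last_letter))))"
  define H where "H = (\<lambda>i. replicate i (last_letter :: 'n)) ` {..<N}"
  have G: "finite G" "G \<subseteq> F" using F by (auto simp: G_def)
  have "length \<nu> < N" if "\<nu> \<in> F" for \<nu>
    using that F by (auto simp: N_def less_Suc_eq_le intro!: Max_ge)
  then have "(\<Sum>\<nu>\<in>F - G. (norm (odometer_coeff L f \<nu>))\<^sup>2) = (\<Sum>\<nu>\<in>F - G. (norm (ell2_nth S \<nu>))\<^sup>2)"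
    by (intro sum.cong) (auto simp: G_def S_def odometer_coeff_eq_sum[where N = N])
  \<comment> \<open>Passing to the full norm of \<open>S\<close> makes the orthogonality of its
    summands available.\<close>
  also have "\<dots> \<le> (norm S)\<^sup>2" using F by (intro ell2_sum_le_norm) auto
  also have "\<dots> = (\<Sum>i<N. (norm (L (ell2_nth f (replicate i last_letter))))\<^sup>2)"
    unfolding S_def using L(2) by (rule norm_sum_left_tensor) simp
  also have "\<dots> \<le> (\<Sum>i<N. C\<^sup>2 * (norm (ell2_nth f (replicate i last_letter)))\<^sup>2)"
  proof (rule sum_mono)
    fix i
    have "norm (L \<eta>) \<le> C * norm \<eta>" for \<eta>
      using onorm[OF L(1), of \<eta>] mult_right_mono[OF C(2), of "norm \<eta>"] by simp
    then show "(norm (L (ell2_nth f (replicate i last_letter))))\<^sup>2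
        \<le> C\<^sup>2 * (norm (ell2_nth f (replicate i last_letter)))\<^sup>2"
      by (metis norm_ge_zero power_mono power_mult_distrib)
  qed
  also have "\<dots> = C\<^sup>2 * (\<Sum>\<mu>\<in>H. (norm (ell2_nth f \<mu>))\<^sup>2)"
    unfolding H_def by (subst sum.reindex) (auto simp: inj_on_def sum_distrib_left)
  finally have first: "(\<Sum>\<nu>\<in>F - G. (norm (odometer_coeff L f \<nu>))\<^sup>2)
      \<le> C\<^sup>2 * (\<Sum>\<mu>\<in>H. (norm (ell2_nth f \<mu>))\<^sup>2)" .
  have "inj_on word_pred G"
    by (rule inj_on_inverseI[of _ word_succ]) (auto simp: G_def intro: word_succ_pred)
  then have "(\<Sum>\<nu>\<in>G. (norm (odometer_coeff L f \<nu>))\<^sup>2)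
      = (\<Sum>\<mu>\<in>word_pred ` G. (norm (ell2_nth f \<mu>))\<^sup>2)"
    by (subst sum.reindex) (auto simp: G_def odometer_coeff_def intro!: sum.cong)
  also have "\<dots> \<le> C\<^sup>2 * (\<Sum>\<mu>\<in>word_pred ` G. (norm (ell2_nth f \<mu>))\<^sup>2)"
    using mult_right_mono[OF C(3) sum_nonneg[of "word_pred ` G" "\<lambda>\<mu>. (norm (ell2_nth f \<mu>))\<^sup>2"]]
    by simp
  finally have second: "(\<Sum>\<nu>\<in>G. (norm (odometer_coeff L f \<nu>))\<^sup>2)
      \<le> C\<^sup>2 * (\<Sum>\<mu>\<in>word_pred ` G. (norm (ell2_nth f \<mu>))\<^sup>2)" .
  have disj: "H \<inter> word_pred ` G = {}"
  proof -
    have "word_pred \<nu> \<notin> H" if "\<nu> \<in> G" for \<nu>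
      using that word_neq_replicate[OF word_pred_neq_last[of \<nu>]] by (auto simp: G_def H_def)
    then show ?thesis by auto
  qed
  have "(\<Sum>\<nu>\<in>F. (norm (odometer_coeff L f \<nu>))\<^sup>2)
      = (\<Sum>\<nu>\<in>F - G. (norm (odometer_coeff L f \<nu>))\<^sup>2) + (\<Sum>\<nu>\<in>G. (norm (odometer_coeff L f \<nu>))\<^sup>2)"
    using F G by (intro sum.subset_diff)
  also have "\<dots> \<le> C\<^sup>2 * (\<Sum>\<mu>\<in>H \<union> word_pred ` G. (norm (ell2_nth f \<mu>))\<^sup>2)"
    using first second G disj
    by (subst sum.union_disjoint) (auto simp: H_def distrib_left)
  also have "\<dots> \<le> C\<^sup>2 * (norm f)\<^sup>2"
    using G by (intro mult_left_mono ell2_sum_le_norm) (auto simp: H_def)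
  finally show ?thesis by (simp add: C_def power_mult_distrib)
qed

text \<open>The finite estimate serves twice: it puts the coefficient family into
  \<open>ell2\<close>, and its constant bounds the resulting operator.\<close>

lemma odometer_map_exists:
  fixes L :: "'e::chilbert_space \<Rightarrow> ('n::{finite, linorder}, 'e) fock_tensor"
  assumes L: "bounded_clinear L" "range L \<subseteq> defect_space L"
  obtains W where "is_odometer_map L W" "\<And>f. norm (W f) \<le> max 1 (onorm L) * norm f"
proof
  define W where "W f = Abs_ell2 (odometer_coeff L f)" for f
  interpret L: bounded_linear L using L(1) by (simp add: bounded_clinear_def)
  have scaleC: "L (c *\<^sub>C \<eta>) = c *\<^sub>C L \<eta>" for c \<eta> using L(1) by (simp add: bounded_clinear_def)
  note bound = sum_odometer_coeff_le[OF L.bounded_linear_axioms L(2)]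
  have nth: "ell2_nth (W f) = odometer_coeff L f" for f
  proof -
    have "(\<lambda>\<nu>. (norm (odometer_coeff L f \<nu>))\<^sup>2) summable_on UNIV"
      using bound[of _ f] by (intro nonneg_bdd_above_summable_on bdd_aboveI) auto
    then show ?thesis by (simp add: W_def Abs_ell2_inverse)
  qed
  show norm_W: "norm (W f) \<le> max 1 (onorm L) * norm f" for f
    by (rule ell2_norm_leI) (auto simp: nth bound)
  have "bounded_linear W"
  proof (rule bounded_linear_intro)
    show "W (f + g) = W f + W g" for f g
      by (rule ell2_eqI) (simp add: nth plus_ell2.rep_eq odometer_coeff_def L.add sum.distrib)
    show "W (r *\<^sub>R f) = r *\<^sub>R W f" for r f
      by (rule ell2_eqI)
        (simp add: nth scaleR_ell2.rep_eq odometer_coeff_def L.scaleR scaleR_right.sum)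
    show "norm (W f) \<le> norm f * max 1 (onorm L)" for f
      using norm_W[of f] by (simp add: mult.commute)
  qed
  moreover have "W (c *\<^sub>C f) = c *\<^sub>C W f" for c f
    by (rule ell2_eqI)
      (simp add: nth scaleC_ell2.rep_eq odometer_coeff_def scaleC complex_vector.scale_sum_right)
  ultimately have clinear: "bounded_clinear W" by (simp add: bounded_clinear_def)
  have last: "W (word_basis (replicate m last_letter) \<otimes> \<eta>)
      = left_tensor (replicate m first_letter) (L \<eta>)" for m \<eta>
  proof (rule ell2_eqI)
    fix \<nu> :: "'n list"
    let ?f = "word_basis (replicate m (last_letter :: 'n)) \<otimes> \<eta>"
    show "ell2_nth (W ?f) \<nu> = ell2_nth (left_tensor (replicate m first_letter) (L \<eta>)) \<nu>"
    proof (cases "\<exists>j\<in>set \<nu>. j \<noteq> first_letter")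
      case True
      \<comment> \<open>Both sides vanish here: \<open>word_pred \<nu>\<close> is not a power of n,
        and removing a prefix 1^m leaves a letter other than 1, where \<open>L \<eta>\<close> has no
        coefficient.\<close>
      have "ell2_nth (L \<eta>) (drop m \<nu>) = 0" if "take m \<nu> = replicate m first_letter"
      proof (rule defect_space_support[of _ L])
        have "set \<nu> = set (take m \<nu>) \<union> set (drop m \<nu>)"
          by (metis append_take_drop_id set_append)
        then show "\<exists>j\<in>set (drop m \<nu>). j \<noteq> first_letter" using True that by auto
      qed (use L(2) in auto)
      then show ?thesis
        using True word_neq_replicate[OF word_pred_neq_last[OF True]]
        by (auto simp: nth odometer_coeff_def ell2_nth_tensor_basis left_tensor.rep_eq)
    next
      case False
      \<comment> \<open>\<open>N\<close> must also exceed m, so that the sum contains i = m, the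
        only term that can be nonzero.\<close>
      obtain N where N: "m < N" "length \<nu> < N"
        using less_Suc_eq_le max.cobounded1 max.cobounded2 by metis
      have "ell2_nth (W ?f) \<nu> = ell2_nth (\<Sum>i<N.
          left_tensor (replicate i first_letter) (L (ell2_nth ?f (replicate i last_letter)))) \<nu>"
        unfolding nth using False N(2) by (rule odometer_coeff_eq_sum)
      also have "\<dots> = (\<Sum>i<N. if i = m
          then ell2_nth (left_tensor (replicate m first_letter) (L \<eta>)) \<nu> else 0)"
        unfolding ell2_nth_sum[OF finite_lessThan]
        by (rule sum.cong)
          (auto simp: ell2_nth_tensor_basis L.zero left_tensor.rep_eq zero_ell2.rep_eq
            replicate_eq_replicate)
      also have "\<dots> = ell2_nth (left_tensor (replicate m first_letter) (L \<eta>)) \<nu>"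
        using N(1) by (subst sum.delta) auto
      finally show ?thesis .
    qed
  qed
  have succ: "W (word_basis \<mu> \<otimes> \<eta>) = word_basis (word_succ \<mu>) \<otimes> \<eta>"
    if \<mu>: "\<exists>j\<in>set \<mu>. j \<noteq> last_letter" for \<mu> \<eta>
  proof (rule ell2_eqI)
    fix \<nu> :: "'n list"
    show "ell2_nth (W (word_basis \<mu> \<otimes> \<eta>)) \<nu> = ell2_nth (word_basis (word_succ \<mu>) \<otimes> \<eta>) \<nu>"
    proof (cases "\<exists>j\<in>set \<nu>. j \<noteq> first_letter")
      case True
      then have "word_pred \<nu> = \<mu> \<longleftrightarrow> \<nu> = word_succ \<mu>"
        using word_pred_succ[OF \<mu>] word_succ_pred[OF True] by metis
      with True show ?thesis by (simp add: nth odometer_coeff_def ell2_nth_tensor_basis)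
    next
      case False
      then have "\<nu> \<noteq> word_succ \<mu>" using word_succ_neq_first[OF \<mu>] by auto
      \<comment> \<open>At an all-1 word only coefficients at powers of n enter, and
        \<open>\<mu>\<close> is not such a power.\<close>
      with False word_neq_replicate[OF \<mu>, THEN not_sym] show ?thesis
        by (simp add: nth odometer_coeff_def ell2_nth_tensor_basis L.zero zero_ell2.rep_eq)
    qed
  qed
  show "is_odometer_map L W"
    unfolding is_odometer_map_def
    using clinear last[of 0] last succ by (auto simp: word_succ_Least Let_def)
qed

section \<open>Uniqueness and the exact norm\<close>

lemma odometer_map_unique:
  fixes L :: "'e::chilbert_space \<Rightarrow> ('n::{finite, linorder}, 'e) fock_tensor"
  assumes "is_odometer_map L V" "is_odometer_map L W"
  shows "V = W"
proof (rule clinear_eq_on_basis)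
  fix \<mu> :: "'n list" and \<eta>
  \<comment> \<open>The three cases match the clauses of \<open>is_odometer_map\<close> and exhaust
    all words.\<close>
  consider "\<mu> = []" | m where "1 \<le> m" "\<mu> = replicate m last_letter" | "\<exists>j\<in>set \<mu>. j \<noteq> last_letter"
    using word_eq_replicate[of \<mu> last_letter]
    by (metis One_nat_def Suc_leI length_greater_0_conv)
  then show "V (word_basis \<mu> \<otimes> \<eta>) = W (word_basis \<mu> \<otimes> \<eta>)"
    using assms by cases (auto simp: is_odometer_map_def Let_def)
qed (use assms in \<open>auto simp: is_odometer_map_def\<close>)

lemma odometer_map_symbol:
  "is_odometer_map L W \<Longrightarrow> W (\<Omega> \<otimes> \<eta>) = L \<eta>"
  by (simp add: is_odometer_map_def)

lemma odometer_map_succ: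
  "is_odometer_map L W \<Longrightarrow> \<exists>j\<in>set \<mu>. j \<noteq> last_letter \<Longrightarrow>
    W (word_basis \<mu> \<otimes> \<eta>) = word_basis (word_succ \<mu>) \<otimes> \<eta>"
  by (simp add: is_odometer_map_def word_succ_Least Let_def)

text \<open>As \<open>odometer_map\<close> is a definite description, unique existence ties the norm
  to the intended map. The lower bound 1 fails on the zero space, which \<open>nontrivial\<close>
  excludes. For n = 1 every word is a power of n, and \<open>L = 0\<close> would give the zero
  odometer map; hence \<open>degenerate_n\<close>.\<close>

theorem proposition4p7:
  fixes L :: "'e::chilbert_space \<Rightarrow> ('n::{finite, linorder}, 'e) fock_tensor"
  assumes separable: "separable_space (euclidean :: 'e topology)"
    and nontrivial: "\<exists>\<eta> :: 'e. \<eta> \<noteq> 0"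
    and degenerate_n: "CARD('n) = 1 \<Longrightarrow> 1 \<le> onorm L"
    and L_bounded: "bounded_clinear L"
    and L_range: "range L \<subseteq> defect_space L"
  shows "(\<exists>!W. is_odometer_map L W) \<and> onorm (odometer_map L) = max 1 (onorm L)"
proof -
  obtain W where W: "is_odometer_map L W" and le: "\<And>f. norm (W f) \<le> max 1 (onorm L) * norm f"
    using odometer_map_exists[OF L_bounded L_range] by blast
  have ex1: "\<exists>!W. is_odometer_map L W"
    using W odometer_map_unique by blast
  have map: "odometer_map L = W"
    using the1_equality[of "is_odometer_map L" W] ex1 W by (simp add: odometer_map_def)
  have bl: "bounded_linear W" using W by (simp add: is_odometer_map_def bounded_clinear_def)
  have "onorm W \<le> max 1 (onorm L)" by (rule onorm_bound) (auto simp: le)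
  moreover have L_le: "onorm L \<le> onorm W"
  proof (rule onorm_bound)
    show "norm (L \<eta>) \<le> onorm W * norm \<eta>" for \<eta>
      using onorm[OF bl, of "\<Omega> \<otimes> \<eta>"] by (simp add: odometer_map_symbol[OF W] norm_tensor_basis)
  qed (rule onorm_pos_le[OF bl])
  moreover have "1 \<le> onorm W"
  proof (cases "CARD('n) = 1")
    case True
    then show ?thesis using degenerate_n L_le by simp
  next
    case False
    obtain \<eta> :: 'e where "\<eta> \<noteq> 0" using nontrivial by blast
    have "\<exists>j :: 'n. j \<noteq> last_letter"
      using False by (metis UNIV_eq_I card_1_singleton_iff One_nat_def insertCI singletonD)
    then obtain j :: 'n where "j \<noteq> last_letter" by blast
    \<comment> \<open>\<open>W\<close> takes the vector at the word \<open>[j]\<close> to the one at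
      \<open>[next_letter j]\<close> with the same norm.\<close>
    then have "norm \<eta> \<le> onorm W * norm \<eta>"
      using onorm[OF bl, of "word_basis [j] \<otimes> \<eta>"] odometer_map_succ[OF W, of "[j]"]
      by (simp add: norm_tensor_basis)
    with \<open>\<eta> \<noteq> 0\<close> show ?thesis by simp
  qed
  ultimately show ?thesis using ex1 map by simp
qed

end
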